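(* Let $n\ge 1$ and $k\ge 2$ be integers and let $\alpha_{ij}\in\mathbb{R}$ for $i=1,\dots,n$, $j=1,\dots,k-1$ be arbitrary real numbers. Let $X=(x_{ij})\in\mathbb{R}^{n\times k}$ be the matrix with entries, for each $i=1,\dots,n$, $$x_{ij}=\cos\alpha_{ij}\prod_{l=1}^{j-1}\sin\alpha_{il}\quad (1\le j\le k-1),\qquad x_{ik}=\prod_{l=1}^{k-1}\sin\alpha_{il}.$$ Then the matrix $Y=XX^T\in\mathbb{R}^{n\times n}$ is symmetric positive semidefinite, satisfies $\operatorname{rank}(Y)\le k$, and satisfies $\operatorname{diag}(Y)=e$, i.e. all diagonal entries of $Y$ equal $1$.
   Context: Empty products are equal to $1$ (so $x_{i1}=\cos\alpha_{i1}$). $\operatorname{diag}(Y)$ denotes the vector of diagonal entries of $Y$, and $e=(1,1,\dots,1)^T$ is the all-ones vector. *)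

theory Defs
  imports Complex_Main "Jordan_Normal_Form.DL_Rank"
begin

text \<open>The entries \<open>x\<^sub>i\<^sub>j\<close> use the mathematical indices \<open>1 \<le> i \<le> n\<close>, \<open>1 \<le> j \<le> k\<close>;
  the angles \<open>\<alpha> i j\<close> are only read for \<open>1 \<le> j \<le> k - 1\<close>.\<close>

definition spherical_entry :: "nat \<Rightarrow> (nat \<Rightarrow> nat \<Rightarrow> real) \<Rightarrow> nat \<Rightarrow> nat \<Rightarrow> real" where
  "spherical_entry k \<alpha> i j =
     (if j < k then cos (\<alpha> i j) * (\<Prod>l\<in>{1..<j}. sin (\<alpha> i l))
      else (\<Prod>l\<in>{1..<k}. sin (\<alpha> i l)))"

text \<open>Matrices of type \<^typ>\<open>real mat\<close> are indexed from 0, hence the shift.\<close>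

definition spherical_mat :: "nat \<Rightarrow> nat \<Rightarrow> (nat \<Rightarrow> nat \<Rightarrow> real) \<Rightarrow> real mat" where
  "spherical_mat n k \<alpha> = mat n k (\<lambda>(i, j). spherical_entry k \<alpha> (i + 1) (j + 1))"

definition symmetric_mat :: "'a mat \<Rightarrow> bool" where
  "symmetric_mat A \<longleftrightarrow> transpose_mat A = A"

text \<open>Symmetry is not part of this predicate; it is asserted separately by \<^const>\<open>symmetric_mat\<close>.\<close>

definition positive_semidefinite :: "real mat \<Rightarrow> bool" where
  "positive_semidefinite A \<longleftrightarrow>
     square_mat A \<and> (\<forall>v \<in> carrier_vec (dim_row A). v \<bullet> (A *\<^sub>v v) \<ge> 0)"

end

theory Submission
  imports Defs
begin

text \<open>\<open>Y\<close> is the Gram matrix of the rows of \<open>X\<close>. For any real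
  \<open>A\<close>, the product of \<open>A\<close> with its transpose is symmetric, and its
  quadratic form at \<open>v\<close> is the squared norm of the transpose applied to
  \<open>v\<close>, hence nonnegative. The rank is bounded by the inner dimension k, since the
  columns of a product lie in the column space of the left factor
  (\<open>rank_mult_le_inner_dim\<close>). The diagonal entries are the squared norms of the rows,
  and each row is a unit vector written in spherical coordinates
  (\<open>spherical_coordinates_norm\<close>).\<close>

lemma (in vec_space) rank_mult_le_inner_dim:
  assumes A: "A \<in> carrier_mat n m" and B: "B \<in> carrier_mat m p"
  shows "rank (A * B) \<le> m"
proof -
  have AB: "A * B \<in> carrier_mat n p"
    using A B by simp
  have colsA: "set (cols A) \<subseteq> carrier_vec n"
    using A cols_dim by blast
  have "set (cols (A * B)) \<subseteq> col_space A"
  proof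
    fix v assume "v \<in> set (cols (A * B))"
    then obtain j where "j < p" and v: "v = col (A * B) j"
      using AB by (auto simp: cols_def)
    then have "v = A *\<^sub>v col B j"
      using col_mult2[OF A B] by simp
    moreover have "col B j \<in> carrier_vec m"
      using B by auto
    ultimately show "v \<in> col_space A"
      using A by (auto simp: col_space_eq[OF A])
  qed
  then have span: "set (cols (A * B)) \<subseteq> span (set (cols A))"
    by (simp add: col_space_def)
  \<comment> \<open>A maximal independent set \<open>S\<close> of columns of \<open>A * B\<close> is
    chosen because its cardinality is the rank.\<close>
  have "\<exists>S. finite S \<and> maximal S (\<lambda>T. T \<subseteq> set (cols (A * B)) \<and> lin_indpt T) \<and> {} \<subseteq> S"
    by (rule maximal_exists_superset[of "set (cols (A * B))"]) (auto simp: lin_dep_def)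
  then obtain S where fin: "finite S"
    and max: "maximal S (\<lambda>T. T \<subseteq> set (cols (A * B)) \<and> lin_indpt T)"
    by blast
  then have S: "S \<subseteq> set (cols (A * B))" "lin_indpt S"
    by (auto simp: maximal_def)
  \<comment> \<open>Steinitz exchange: \<open>S\<close> is independent inside the span of the
    columns of \<open>A\<close>. Only the count matters: \<open>card C\<close> is nonnegative, so
    the integer difference is too.\<close>
  obtain C :: "'a vec set" where "int (card C) \<le> int (card (set (cols A))) - int (card S)"
    using replacement[OF fin _ _ S(2), of "set (cols A)"] colsA
      subset_trans[OF S(1) span] by auto
  then have "card S \<le> card (set (cols A))"
    by linarith
  also have "\<dots> \<le> m"
    using card_length[of "cols A"] A by simp
  finally show ?thesis
    using rank_card_indpt[OF AB max] by simp
qed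

lemma symmetric_mat_mult_transpose:
  fixes A :: "'a :: comm_semiring_0 mat"
  shows "symmetric_mat (A * A\<^sup>T)"
  unfolding symmetric_mat_def
  by (subst transpose_mult[of _ "dim_row A" "dim_col A" _ "dim_row A"]) auto

lemma positive_semidefinite_mult_transpose: "positive_semidefinite (A * A\<^sup>T)"
  unfolding positive_semidefinite_def
proof (intro conjI ballI)
  show "square_mat (A * A\<^sup>T)"
    by simp
next
  fix v :: "real vec" assume "v \<in> carrier_vec (dim_row (A * A\<^sup>T))"
  then have v: "v \<in> carrier_vec (dim_row A)"
    by simp
  have A: "A \<in> carrier_mat (dim_row A) (dim_col A)"
    by simp
  have w: "A\<^sup>T *\<^sub>v v \<in> carrier_vec (dim_col A)"
    using v by (intro mult_mat_vec_carrier[of _ _ "dim_row A"]) auto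
  have "v \<bullet> (A * A\<^sup>T *\<^sub>v v) = v \<bullet> (A *\<^sub>v (A\<^sup>T *\<^sub>v v))"
    using v by (subst assoc_mult_mat_vec[of _ "dim_row A" "dim_col A" _ "dim_row A"]) auto
  \<comment> \<open>\<open>A\<close> moves across the inner product as its adjoint, leaving a sum of
    squares.\<close>
  also have "\<dots> = (A\<^sup>T *\<^sub>v v) \<bullet> (A\<^sup>T *\<^sub>v v)"
    using transpose_vec_mult_scalar[OF A w v] by simp
  also have "\<dots> \<ge> 0"
    by (auto simp: scalar_prod_def intro: sum_nonneg)
  finally show "v \<bullet> (A * A\<^sup>T *\<^sub>v v) \<ge> 0" .
qed

text \<open>The squared product of sines is the part of the unit length not yet used up by the
  cosine terms. Each new angle splits this remainder by Pythagoras, so the total stays 1.\<close>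

lemma spherical_coordinates_norm:
  fixes a :: "nat \<Rightarrow> real"
  assumes "m \<ge> 1"
  shows "(\<Sum>j\<in>{1..<m}. (cos (a j) * (\<Prod>l\<in>{1..<j}. sin (a l)))\<^sup>2)
       + (\<Prod>l\<in>{1..<m}. sin (a l))\<^sup>2 = 1"
  using assms
proof (induction m rule: dec_induct)
  case base
  then show ?case by simp
next
  case (step m)
  let ?P = "\<Prod>l\<in>{1..<m}. sin (a l)"
  \<comment> \<open>The Pythagorean identity is withheld so that both sides expand to the same
    polynomial; it is applied in the last step.\<close>
  have "(cos (a m) * ?P)\<^sup>2 + (?P * sin (a m))\<^sup>2 = ((cos (a m))\<^sup>2 + (sin (a m))\<^sup>2) * ?P\<^sup>2"
    by (simp add: power_mult_distrib algebra_simps del: sin_cos_squared_add sin_cos_squared_add2)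
  then show ?case
    using step by simp
qed

lemma spherical_entry_norm:
  assumes "k \<ge> 1"
  shows "(\<Sum>j\<in>{1..k}. (spherical_entry k \<alpha> i j)\<^sup>2) = 1"
proof -
  \<comment> \<open>Within this range only the index \<open>k\<close> takes the cosine-free branch
    of \<open>spherical_entry\<close>.\<close>
  have "{1..k} = insert k {1..<k}"
    using assms by auto
  then show ?thesis
    using spherical_coordinates_norm[OF assms, of "\<alpha> i"]
    by (simp add: spherical_entry_def)
qed

theorem theorem2p1:
  fixes n k :: nat and \<alpha> :: "nat \<Rightarrow> nat \<Rightarrow> real" and X Y :: "real mat"
  assumes "n \<ge> 1" and "k \<ge> 2"
    and "X = spherical_mat n k \<alpha>"
    and "Y = X * transpose_mat X"
  shows "Y \<in> carrier_mat n n \<and> symmetric_mat Y \<and> positive_semidefinite Y \<and>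
         vec_space.rank n Y \<le> k \<and>
         vec_of_list (diag_mat Y) = vec n (\<lambda>_. 1)"
proof (intro conjI)
  have X: "X \<in> carrier_mat n k"
    using assms by (simp add: spherical_mat_def)
  show Y: "Y \<in> carrier_mat n n"
    using X assms by simp
  show "symmetric_mat Y" "positive_semidefinite Y"
    using assms by (simp_all add: symmetric_mat_mult_transpose positive_semidefinite_mult_transpose)
  show "vec_space.rank n Y \<le> k"
    using vec_space.rank_mult_le_inner_dim[OF X, of "X\<^sup>T" n] X assms by simp
  show "vec_of_list (diag_mat Y) = vec n (\<lambda>_. 1)"
  proof (rule eq_vecI)
    fix i assume "i < dim_vec (vec n (\<lambda>_. 1 :: real))"
    then have i: "i < n"
      by simp
    have "Y $$ (i, i) = (\<Sum>j<k. (spherical_entry k \<alpha> (i + 1) (j + 1))\<^sup>2)"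
      using i assms
      by (simp add: spherical_mat_def scalar_prod_def power2_eq_square atLeast0LessThan)
    \<comment> \<open>Passes from matrix columns counted from 0 to coordinates counted from
      1.\<close>
    also have "\<dots> = (\<Sum>j\<in>{1..k}. (spherical_entry k \<alpha> (i + 1) j)\<^sup>2)"
      by (simp add: sum.atLeast1_atMost_eq)
    also have "\<dots> = 1"
      using assms by (intro spherical_entry_norm) simp
    finally show "vec_of_list (diag_mat Y) $ i = vec n (\<lambda>_. 1) $ i"
      using i Y by (simp add: diag_mat_def vec_of_list_index)
  qed (use Y in \<open>simp add: diag_mat_def\<close>)
qed

end
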